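(* Let $k\geq 1$ be an integer and let $G$ be a graph of order $n$. If \[ \mu(G)>\frac{k}{2}+\sqrt{kn+\frac{k^2-4k}{4}}, \] then $G$ contains the cycle $C_{2l+2}$ as a subgraph for every $l=1,\ldots,k$.
   Context: All graphs are finite and simple. $\mu(G)$ denotes the largest eigenvalue of the adjacency matrix of $G$. $C_r$ denotes the cycle on $r$ vertices. *)

theory Defs
  imports "HOL-Analysis.Analysis"
begin

definition simple_graph :: "('a::finite \<Rightarrow> 'a \<Rightarrow> bool) \<Rightarrow> bool" where
  "simple_graph E \<longleftrightarrow> (\<forall>u v. E u v \<longrightarrow> E v u) \<and> (\<forall>v. \<not> E v v)"

definition adj_matrix :: "('a::finite \<Rightarrow> 'a \<Rightarrow> bool) \<Rightarrow> real^'a^'a" where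
  "adj_matrix E = (\<chi> i j. if E i j then 1 else 0)"

definition eigenvalues :: "real^'n^'n \<Rightarrow> real set" where
  "eigenvalues A = {c. \<exists>x. x \<noteq> 0 \<and> A *v x = c *\<^sub>R x}"

definition mu :: "('a::finite \<Rightarrow> 'a \<Rightarrow> bool) \<Rightarrow> real" where
  "mu E = Max (eigenvalues (adj_matrix E))"

definition has_cycle :: "('a \<Rightarrow> 'a \<Rightarrow> bool) \<Rightarrow> nat \<Rightarrow> bool" where
  "has_cycle E r \<longleftrightarrow> 3 \<le> r \<and> (\<exists>vs. length vs = r \<and> distinct vs \<and>
      (\<forall>i<r. E (vs ! i) (vs ! ((i + 1) mod r))))"

end

theory Submission
  imports Defs
begin

text \<open>If G has no cycle of order 2l + 2, then for every vertex u the graph G - u has no path of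
  order 2l + 1 with both ends in A = N(u). An Erdos-Gallai type lemma for a vertex partition A, B
  bounds the sum of the degrees over A in such a graph by (2l - 1)|A| + l|B|, where edges inside B
  are ignored. Hence every row sum of M^2 - l M is at most l(n - 1), where M is the adjacency
  matrix. Pairing with a nonnegative eigenvector gives mu^2 - l mu \<le> l(n - 1), which contradicts
  the hypothesis because l \<le> k.

  The lemma goes by induction on the number of vertices: vertices of small degree can be deleted,
  so let p be a longest path. Without the forbidden path, the vertices at distance 2l along a path
  or cycle are not both in A, and no two neighbours are both in B; this forces the ends of long
  paths to alternate between A and B and rules out cycles of order above 2l. As in Dirac's theorem
  on long paths, counting the neighbours of both ends of p then leaves only the case that p closes
  to a short cycle, whose vertices form a component that can be deleted.\<close>

section \<open>Paths with both ends in one part\<close>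

text \<open>Here \<open>f i\<close> stands for membership of the \<open>i\<close>-th path vertex in
  \<open>A\<close>. If \<open>f i\<close> holds, \<open>window\<close> excludes
  \<open>i + 2 * k\<close>, so \<open>cover\<close> gives \<open>i + 2 * k + 1\<close>; then
  \<open>window\<close> excludes \<open>i + 1\<close> and \<open>cover\<close> gives
  \<open>i + 2\<close>. Each step looks \<open>2 * k + 1\<close> positions ahead, whence the length
  conditions.\<close>

lemma alternating_prefix:
  fixes f :: "nat \<Rightarrow> bool"
  assumes "k \<ge> 1" and "f 0"
    and cover: "\<And>i. Suc i < m \<Longrightarrow> f i \<or> f (Suc i)"
    and window: "\<And>i. i + 2 * k < m \<Longrightarrow> \<not> (f i \<and> f (i + 2 * k))"
  shows "2 * s + 2 * k < m \<Longrightarrow> f (2 * s)"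
    and "2 * s + 2 * k + 1 < m \<Longrightarrow> \<not> f (2 * s + 1)"
proof -
  have step: "\<not> f (i + 1) \<and> f (i + 2)" if "f i" "i + 2 * k + 1 < m" for i
  proof -
    have "\<not> f (i + 2 * k)"
      using window[of i] that by simp
    then have "f (i + 1 + 2 * k)"
      using cover[of "i + 2 * k"] that by simp
    then have "\<not> f (i + 1)"
      using window[of "i + 1"] that by simp
    then show ?thesis
      using cover[of "i + 1"] that \<open>k \<ge> 1\<close> by simp
  qed
  show even: "f (2 * s)" if "2 * s + 2 * k < m" for s
    using that
  proof (induction s)
    case (Suc s)
    then show ?case using step[of "2 * s"] by simp
  qed (use \<open>f 0\<close> in simp)
  show "\<not> f (2 * s + 1)" if "2 * s + 2 * k + 1 < m"
    using step[of "2 * s"] even[of s] that by simp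
qed

lemma hd_tl_conv_nth: "2 \<le> length xs \<Longrightarrow> hd (tl xs) = xs ! 1"
  by (metis One_nat_def Suc_1 Suc_le_lessD drop0 drop_Suc hd_drop_conv_nth)

lemma last_tl_longer: "2 \<le> length xs \<Longrightarrow> last (tl xs) = last xs"
  by (cases xs) auto

lemma successively_take: "successively R xs \<Longrightarrow> successively R (take n xs)"
  by (metis append_take_drop_id successively_append_iff)

lemma successively_drop: "successively R xs \<Longrightarrow> successively R (drop n xs)"
  by (metis append_take_drop_id successively_append_iff)

lemma successively_rotate:
  assumes "successively R xs" "R (last xs) (hd xs)"
  shows "successively R (rotate n xs) \<and> R (last (rotate n xs)) (hd (rotate n xs))"
proof (induction n)
  case 0
  then show ?case using assms by simp
next
  case (Suc n)
  then show ?case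
    by (cases "rotate n xs")
      (auto simp: successively_append_iff successively_Cons rotate1_hd_tl split: if_splits)
qed

text \<open>\<open>indep\<close> encodes that edges inside \<open>B\<close> are ignored.
  \<open>A\<close> and \<open>B\<close> are sets within the type, so deleting vertices changes
  neither the type nor \<open>E\<close>.\<close>

locale graph_with_independent_part =
  fixes E :: "'a \<Rightarrow> 'a \<Rightarrow> bool" and A B :: "'a set"
  assumes finite_A: "finite A" and finite_B: "finite B" and disjoint: "A \<inter> B = {}"
    and sym: "E u v \<Longrightarrow> E v u" and irrefl: "\<not> E v v"
    and indep: "u \<in> B \<Longrightarrow> v \<in> B \<Longrightarrow> \<not> E u v"
begin

definition path_in :: "'a list \<Rightarrow> bool" where
  "path_in xs \<longleftrightarrow> xs \<noteq> [] \<and> distinct xs \<and> set xs \<subseteq> A \<union> B \<and> successively E xs"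

definition nbrs :: "'a \<Rightarrow> 'a set" where
  "nbrs v = {w \<in> A \<union> B. E v w}"

lemma finite_nbrs: "finite (nbrs v)"
  unfolding nbrs_def using finite_A finite_B by simp

lemma path_in_take: "path_in xs \<Longrightarrow> n > 0 \<Longrightarrow> path_in (take n xs)"
  unfolding path_in_def by (auto simp: successively_take dest: in_set_takeD)

lemma path_in_drop: "path_in xs \<Longrightarrow> n < length xs \<Longrightarrow> path_in (drop n xs)"
  unfolding path_in_def by (auto simp: successively_drop dest: in_set_dropD)

lemma path_in_rev: "path_in (rev xs) \<longleftrightarrow> path_in xs"
proof -
  have "E v u \<longleftrightarrow> E u v" for u v using sym by blast
  then show ?thesis by (simp add: path_in_def)
qed

lemma path_in_rotate:
  "path_in xs \<Longrightarrow> E (last xs) (hd xs) \<Longrightarrow> path_in (rotate n xs)"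
  unfolding path_in_def using successively_rotate by auto

lemma path_in_flip_prefix:
  assumes "path_in (xs @ ys)" "xs \<noteq> []" "ys \<noteq> []" "E (hd xs) (hd ys)"
  shows "path_in (rev xs @ ys)"
proof -
  have "path_in xs"
    using assms unfolding path_in_def by (auto simp: successively_append_iff)
  then have "path_in (rev xs)" by (simp add: path_in_rev)
  then show ?thesis
    using assms unfolding path_in_def by (auto simp: successively_append_iff last_rev)
qed

lemma path_in_nth_edge: "path_in xs \<Longrightarrow> Suc i < length xs \<Longrightarrow> E (xs ! i) (xs ! Suc i)"
  unfolding path_in_def by (simp add: successively_conv_nth)

lemma path_in_nth_mem: "path_in xs \<Longrightarrow> i < length xs \<Longrightarrow> xs ! i \<in> A \<union> B"
  unfolding path_in_def using nth_mem by blast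

lemma edge_meets_A:
  assumes "u \<in> A \<union> B" "v \<in> A \<union> B" "E u v"
  shows "u \<in> A \<or> v \<in> A"
  using assms indep by blast

lemma path_in_cover: "path_in xs \<Longrightarrow> Suc i < length xs \<Longrightarrow> xs ! i \<in> A \<or> xs ! Suc i \<in> A"
  using edge_meets_A path_in_nth_edge path_in_nth_mem Suc_lessD by metis

end

text \<open>Lengths count vertices: a further vertex adjacent to all of \<open>A\<close> would close
  a forbidden path to a cycle of order \<open>2 * k + 2\<close>.\<close>

locale no_even_path = graph_with_independent_part +
  fixes k :: nat
  assumes k_pos: "k \<ge> 1"
    and no_path: "\<lbrakk>path_in xs; length xs = 2 * k + 1; hd xs \<in> A\<rbrakk> \<Longrightarrow> last xs \<notin> A"
begin

lemma no_window:
  assumes "path_in xs" "i + 2 * k < length xs"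
  shows "\<not> (xs ! i \<in> A \<and> xs ! (i + 2 * k) \<in> A)"
proof -
  let ?w = "take (2 * k + 1) (drop i xs)"
  have "path_in ?w"
    using assms by (intro path_in_take path_in_drop) auto
  moreover have len: "length ?w = 2 * k + 1"
    using assms by simp
  moreover have "hd ?w = xs ! i"
    using assms by (simp add: hd_drop_conv_nth)
  moreover have "last ?w = xs ! (i + 2 * k)"
  proof -
    have "last ?w = ?w ! (2 * k)"
      using len by (metis add_diff_cancel_right' last_conv_nth list.size(3) add_is_0 one_neq_zero)
    then show ?thesis using assms by simp
  qed
  ultimately show ?thesis
    using no_path[of ?w] by auto
qed

lemma path_prefix_alternates:
  assumes "path_in xs" "xs ! 0 \<in> A"
  shows "2 * s + 2 * k < length xs \<Longrightarrow> xs ! (2 * s) \<in> A"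
    and "2 * s + 2 * k + 1 < length xs \<Longrightarrow> xs ! (2 * s + 1) \<notin> A"
  using alternating_prefix[of k "\<lambda>i. xs ! i \<in> A" "length xs" s] k_pos
    path_in_cover[OF assms(1)] no_window[OF assms(1)] assms(2) by blast+

text \<open>Alternation from the first vertex would put into \<open>A\<close> the vertex exactly
  \<open>2 * k\<close> steps before the last one.\<close>

lemma odd_path_short:
  assumes "path_in xs" "hd xs \<in> A" "last xs \<in> A" "odd (length xs)"
  shows "length xs < 2 * k + 1"
proof (rule ccontr)
  assume *: "\<not> length xs < 2 * k + 1"
  obtain s where s: "length xs = 2 * s + 2 * k + 1"
  proof
    show "length xs = 2 * ((length xs - 2 * k - 1) div 2) + 2 * k + 1"
      using * assms(4) by presburger
  qed
  have ne: "xs \<noteq> []" using s by auto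
  have "xs ! (2 * s) \<in> A"
    using path_prefix_alternates(1)[OF assms(1), of s] assms(2) ne s by (simp add: hd_conv_nth)
  moreover have "xs ! (2 * s + 2 * k) \<in> A"
    using assms(3) ne s by (simp add: last_conv_nth)
  ultimately show False
    using no_window[OF assms(1), of "2 * s"] s by simp
qed

text \<open>Around a cycle the sequence of positions never ends, so alternation from a vertex in
  \<open>A\<close> reaches the vertex \<open>2 * k\<close> steps on, which \<open>window\<close>
  excludes.\<close>

lemma cycle_short:
  assumes "path_in xs" "E (last xs) (hd xs)"
  shows "length xs < 2 * k + 1"
proof (rule ccontr)
  assume *: "\<not> length xs < 2 * k + 1"
  let ?n = "length xs"
  have n: "?n > 0" "xs \<noteq> []" using * by auto
  have rot: "path_in (rotate i xs)" for i
    using path_in_rotate assms by blast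
  have nth: "rotate i xs ! j = xs ! ((i + j) mod ?n)" if "j < ?n" for i j
    using that by (simp add: nth_rotate add.commute)
  have cover: "xs ! (i mod ?n) \<in> A \<or> xs ! (Suc i mod ?n) \<in> A" for i
    using path_in_cover[OF rot[of i], of 0] nth[of 0 i] nth[of 1 i] * n k_pos by simp
  have window: "\<not> (xs ! (i mod ?n) \<in> A \<and> xs ! ((i + 2 * k) mod ?n) \<in> A)" for i
    using no_window[OF rot[of i], of 0] nth[of 0 i] nth[of "2 * k" i] * n by simp
  obtain i where i: "xs ! (i mod ?n) \<in> A"
    using cover by blast
  \<comment> \<open>\<open>4 * k + 1\<close> is the least length for which
    \<open>alternating_prefix\<close> yields position \<open>2 * k\<close>.\<close>
  have "xs ! ((i + 2 * k) mod ?n) \<in> A"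
    using alternating_prefix(1)[of k "\<lambda>j. xs ! ((i + j) mod ?n) \<in> A" "4 * k + 1" k]
      k_pos i cover window by (simp add: add.assoc[symmetric])
  then show False using window i by blast
qed

section \<open>Rotations and the ends of a longest path\<close>

text \<open>The index is that of the predecessor of a neighbour of \<open>hd p\<close>, the vertex
  that a rotation moves to the front. It also numbers the path edge from \<open>p ! i\<close> to
  \<open>p ! Suc i\<close>.\<close>

definition links :: "'a list \<Rightarrow> nat set" where
  "links p = {i. Suc i < length p \<and> E (hd p) (p ! Suc i)}"

lemma finite_links: "finite (links p)"
  by (rule finite_subset[of _ "{..<length p}"]) (auto simp: links_def)

text \<open>The first \<open>i + 2\<close> vertices close to a cycle, so \<open>cycle_short\<close>
  applies.\<close>

lemma links_bound:
  assumes "path_in p" "i \<in> links p"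
  shows "i + 2 \<le> 2 * k"
proof -
  let ?q = "take (Suc (Suc i)) p"
  have i: "Suc i < length p" "E (hd p) (p ! Suc i)"
    using assms(2) by (auto simp: links_def)
  have "last ?q = p ! Suc i"
    using i by (simp add: take_Suc_conv_app_nth)
  moreover have "hd ?q = hd p" by simp
  ultimately have "length ?q < 2 * k + 1"
    using cycle_short[of ?q] path_in_take[OF assms(1)] i sym by simp
  then show ?thesis using i by simp
qed

text \<open>The rotation of Posa: if the first vertex of the path is adjacent to \<open>p ! Suc i\<close>,
  then this is a path again.\<close>

definition flip :: "nat \<Rightarrow> 'a list \<Rightarrow> 'a list" where
  "flip i p = rev (take (Suc i) p) @ drop (Suc i) p"

lemma length_flip [simp]: "length (flip i p) = length p"
  by (simp add: flip_def)

lemma flip: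
  assumes "path_in p" "i \<in> links p"
  shows path_in_flip: "path_in (flip i p)"
    and hd_flip: "hd (flip i p) = p ! i"
    and last_flip: "last (flip i p) = last p"
proof -
  have i: "Suc i < length p" "E (hd p) (p ! Suc i)"
    using assms(2) by (auto simp: links_def)
  show "path_in (flip i p)"
    unfolding flip_def using assms i by (intro path_in_flip_prefix) (auto simp: hd_drop_conv_nth)
  show "hd (flip i p) = p ! i"
    using i by (simp add: flip_def take_Suc_conv_app_nth)
  show "last (flip i p) = last p"
    using i by (simp add: flip_def)
qed

lemma nbrs_hd_longest:
  assumes "path_in p" and longest: "\<And>q. path_in q \<Longrightarrow> length q \<le> length p"
  shows "nbrs (hd p) \<subseteq> set p"
proof
  fix w assume w: "w \<in> nbrs (hd p)"
  show "w \<in> set p"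
  proof (rule ccontr)
    assume "w \<notin> set p"
    then have "path_in (w # p)"
      using w assms(1) sym by (auto simp: path_in_def nbrs_def successively_Cons)
    from longest[OF this] show False by simp
  qed
qed

text \<open>Maximality keeps every neighbour of \<open>hd p\<close> on the path, so
  \<open>links\<close> counts the degree.\<close>

lemma card_links_longest:
  assumes "path_in p" and longest: "\<And>q. path_in q \<Longrightarrow> length q \<le> length p"
  shows "card (links p) = card (nbrs (hd p))"
proof (rule bij_betw_same_card)
  have p: "p \<noteq> []" "distinct p" "set p \<subseteq> A \<union> B"
    using assms(1) by (auto simp: path_in_def)
  show "bij_betw (\<lambda>i. p ! Suc i) (links p) (nbrs (hd p))"
    unfolding bij_betw_def
  proof
    show "inj_on (\<lambda>i. p ! Suc i) (links p)"
      using p by (auto simp: inj_on_def links_def nth_eq_iff_index_eq)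
    show "(\<lambda>i. p ! Suc i) ` links p = nbrs (hd p)"
    proof
      show "(\<lambda>i. p ! Suc i) ` links p \<subseteq> nbrs (hd p)"
        using p nth_mem by (fastforce simp: links_def nbrs_def)
      show "nbrs (hd p) \<subseteq> (\<lambda>i. p ! Suc i) ` links p"
      proof
        fix w assume w: "w \<in> nbrs (hd p)"
        then have "w \<in> set p" using nbrs_hd_longest[OF assms] by blast
        then obtain j where j: "j < length p" "p ! j = w" by (auto simp: in_set_conv_nth)
        have "j \<noteq> 0"
          using j w p(1) irrefl[of w] by (auto simp: nbrs_def hd_conv_nth intro!: gr0I)
        then obtain i where "j = Suc i" using not0_implies_Suc by blast
        then show "w \<in> (\<lambda>i. p ! Suc i) ` links p"
          using j w by (auto simp: links_def nbrs_def)
      qed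
    qed
  qed
qed

text \<open>If \<open>hd p\<close> were in \<open>B\<close>, every rotation would again start in
  \<open>B\<close>. As \<open>B\<close> is independent, no two links are consecutive; being at most
  \<open>2 * k - 2\<close>, they number at most \<open>k\<close>, against
  \<open>degB\<close>.\<close>

lemma longest_path_hd_in_A:
  assumes p: "path_in p" and longest: "\<And>q. path_in q \<Longrightarrow> length q \<le> length p"
    and degB: "\<And>v. v \<in> B \<Longrightarrow> k + 1 \<le> card (nbrs v)"
    and len: "length p \<ge> 2 * k + 2" "last p \<in> B \<Longrightarrow> length p \<ge> 2 * k + 3"
  shows "hd p \<in> A"
proof (rule ccontr)
  assume "hd p \<notin> A"
  moreover have ne: "p \<noteq> []" using p by (simp add: path_in_def)
  ultimately have hdB: "hd p \<in> B"
    using path_in_nth_mem[OF p, of 0] by (auto simp: hd_conv_nth)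
  have tl: "path_in (tl p)" "hd (tl p) \<in> A"
  proof -
    show "path_in (tl p)"
      using path_in_drop[OF p, of 1] len by (simp add: drop_Suc)
    have "p ! 1 \<in> A"
      using path_in_cover[OF p, of 0] \<open>hd p \<notin> A\<close> len ne by (auto simp: hd_conv_nth)
    then show "hd (tl p) \<in> A"
      using hd_tl_conv_nth[of p] len by simp
  qed
  have last_tl: "last (tl p) = last p"
    using last_tl_longer[of p] len by simp
  \<comment> \<open>otherwise, the flipped path and the path without its first vertex, both cut down to end in \<open>A\<close>,
    have consecutive orders, so one of them is a long path of odd order\<close>
  have in_B: "p ! i \<in> B" if i: "i \<in> links p" for i
  proof (rule ccontr)
    assume "p ! i \<notin> B"
    moreover have "i < length p" using i by (auto simp: links_def)
    ultimately have iA: "p ! i \<in> A"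
      using path_in_nth_mem[OF p] by blast
    let ?q = "flip i p"
    note q = path_in_flip[OF p i] hd_flip[OF p i] last_flip[OF p i]
    show False
    proof (cases "last p \<in> A")
      case True
      then show False
        using odd_path_short[of ?q] odd_path_short[of "tl p"] q iA tl last_tl len ne
        by (cases "even (length p)") auto
    next
      case False
      then have lastB: "last p \<in> B"
        using p last_in_set[OF ne] False unfolding path_in_def by blast
      \<comment> \<open>The predecessor of a last vertex in \<open>B\<close> lies in
        \<open>A\<close>. The vertex lost here is why \<open>len\<close> asks for order
        \<open>2 * k + 3\<close> in this case.\<close>
      have cut: "path_in (butlast xs) \<and> hd (butlast xs) = hd xs \<and> last (butlast xs) \<in> A"
        if xs: "path_in xs" "last xs = last p" "length xs \<ge> 2" for xs
      proof -
        have 1: "path_in (butlast xs)"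
          using path_in_take[OF xs(1), of "length xs - 1"] xs by (simp add: butlast_conv_take)
        have 2: "hd (butlast xs) = hd xs"
          using xs(3) by (cases xs; cases "tl xs") auto
        have "xs ! (length xs - 2) \<in> A"
        proof -
          have "xs \<noteq> []" using xs(3) by auto
          then have "xs ! Suc (length xs - 2) = last xs"
            using xs(3) by (simp add: last_conv_nth Suc_diff_Suc numeral_2_eq_2)
          then show ?thesis
            using path_in_cover[OF xs(1), of "length xs - 2"] xs False by auto
        qed
        moreover have "butlast xs \<noteq> []"
          using xs(3) by (cases xs; cases "tl xs") auto
        ultimately have 3: "last (butlast xs) \<in> A"
          using xs(3) by (simp add: last_conv_nth nth_butlast numeral_2_eq_2)
        show ?thesis using 1 2 3 by blast
      qed
      have "length p \<ge> 2 * k + 3" using len lastB by blast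
      then show False
        using odd_path_short[of "butlast ?q"] odd_path_short[of "butlast (tl p)"]
          cut[of ?q] cut[of "tl p"] q iA tl last_tl ne
        by (cases "even (length p)") auto
    qed
  qed
  have "links p \<inter> Suc ` links p = {}"
  proof -
    have False if i: "i \<in> links p" "Suc i \<in> links p" for i
      using path_in_nth_edge[OF p, of i] in_B[OF i(1)] in_B[OF i(2)] indep i
      by (auto simp: links_def)
    then show ?thesis by blast
  qed
  moreover have "links p \<union> Suc ` links p \<subseteq> {..<2 * k}"
    using links_bound[OF p] by fastforce
  ultimately have "card (links p) + card (Suc ` links p) \<le> 2 * k"
    by (metis card_Un_disjoint card_lessThan card_mono finite_imageI finite_lessThan finite_links)
  then have "card (links p) \<le> k"
    by (simp add: card_image)
  then show False
    using card_links_longest[OF p longest] degB[OF hdB] by simp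
qed

text \<open>Reversal sends edge position \<open>i\<close> to \<open>length p - 2 - i\<close>, which
  lets the links of both ends be compared as edge positions of \<open>p\<close>.\<close>

lemma rev_links:
  assumes "i \<in> links (rev p)"
  shows "length p - 2 - i \<in> {j. Suc j < length p \<and> E (p ! j) (last p)}"
  using assms sym by (auto simp: links_def rev_nth hd_rev numeral_2_eq_2)

text \<open>If the ends share an edge position, the path closes to a cycle. Otherwise both ends lie
  in \<open>A\<close> and the order is \<open>2 * k + 2 * t\<close>; at least \<open>2 * k\<close>
  positions used by the ends and \<open>2 * t\<close> positions barred to both cannot fit into the
  \<open>2 * k + 2 * t - 1\<close> available.\<close>

lemma longest_path_short:
  assumes p: "path_in p" and longest: "\<And>q. path_in q \<Longrightarrow> length q \<le> length p"
    and degA: "\<And>v. v \<in> A \<Longrightarrow> k \<le> card (nbrs v)"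
    and degB: "\<And>v. v \<in> B \<Longrightarrow> k + 1 \<le> card (nbrs v)"
  shows "\<exists>q. path_in q \<and> length q = length p \<and> length p \<le> 2 * k \<and> E (last q) (hd q)"
proof -
  let ?m = "length p"
  define X where "X = links p"
  define Y where "Y = (\<lambda>i. ?m - 2 - i) ` links (rev p)"
  have p': "path_in (rev p)" using p by (simp add: path_in_rev)
  have longest': "length q \<le> length (rev p)" if "path_in q" for q
    using longest that by simp
  have ne: "p \<noteq> []" using p by (simp add: path_in_def)
  have ends: "hd p \<in> A \<union> B" "last p \<in> A \<union> B"
    using p hd_in_set[OF ne] last_in_set[OF ne] unfolding path_in_def by blast+
  have Y: "Suc j < ?m" "E (p ! j) (last p)" if "j \<in> Y" for j
    using that rev_links[of _ p] unfolding Y_def by auto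
  have inj: "inj_on (\<lambda>i. ?m - 2 - i) (links (rev p))"
    by (auto simp: inj_on_def links_def)
  have cardX: "card X = card (nbrs (hd p))"
    unfolding X_def by (rule card_links_longest[OF p longest])
  have cardY: "card Y = card (nbrs (last p))"
    using card_links_longest[OF p' longest'] ne card_image[OF inj]
    unfolding Y_def by (simp add: hd_rev)
  have fin: "finite X" "finite Y"
    unfolding X_def Y_def using finite_links by auto
  have deg: "k \<le> card (nbrs v)" if "v \<in> A \<union> B" for v
    using degA degB that by fastforce
  show ?thesis
  proof (cases "X \<inter> Y = {}")
    case False
    \<comment> \<open>Now \<open>hd p\<close> is adjacent to \<open>p ! Suc i\<close> and
      \<open>last p\<close> to \<open>p ! i\<close>, so the path rotated at \<open>i\<close> has
      adjacent ends.\<close>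
    then obtain i where i: "i \<in> X" "i \<in> Y" by blast
    note q = flip[OF p i(1)[unfolded X_def]]
    have "E (last (flip i p)) (hd (flip i p))"
      using q Y[OF i(2)] sym by simp
    moreover from cycle_short[OF q(1) this] have "?m \<le> 2 * k" by simp
    ultimately show ?thesis using q(1) by (intro exI[of _ "flip i p"]) simp
  next
    case True
    have sub: "X \<union> Y \<subseteq> {..<?m - 1}"
      using Y by (fastforce simp: X_def links_def)
    have "card X + card Y \<le> ?m - 1"
      using card_mono[OF _ sub] card_Un_disjoint[OF fin True] by simp
    then have len: "card (nbrs (hd p)) + card (nbrs (last p)) + 1 \<le> ?m"
      using cardX cardY ne by (cases p) auto
    \<comment> \<open>An end in \<open>B\<close> has degree at least \<open>k + 1\<close>, so
      \<open>len\<close> gives order \<open>2 * k + 2\<close>, and \<open>2 * k + 3\<close> if both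
      ends are in \<open>B\<close>, as \<open>longest_path_hd_in_A\<close> requires.\<close>
    have hdA: "hd p \<in> A"
    proof (rule ccontr)
      assume "hd p \<notin> A"
      then have "hd p \<in> B" using ends by blast
      then have "hd p \<in> A"
        using len degB[of "hd p"] degB[of "last p"] deg[of "last p"] ends
        by (intro longest_path_hd_in_A[OF p longest degB]) auto
      then show False using \<open>hd p \<notin> A\<close> by blast
    qed
    have lastA: "last p \<in> A"
    proof (rule ccontr)
      assume "last p \<notin> A"
      then have "last p \<in> B" using ends by blast
      then have "hd (rev p) \<in> A"
        using len degB[of "hd p"] degB[of "last p"] deg[of "hd p"] ends ne
        by (intro longest_path_hd_in_A[OF p' longest' degB]) (auto simp: last_rev)
      then show False using \<open>last p \<notin> A\<close> ne by (simp add: hd_rev)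
    qed
    have m: "?m \<ge> 2 * k + 1"
      using len deg[of "hd p"] deg[of "last p"] ends by linarith
    then have "even ?m"
      using odd_path_short[OF p hdA lastA] by auto
    define t where "t = (?m - 2 * k) div 2"
    have mt: "?m = 2 * t + 2 * k"
      unfolding t_def using \<open>even ?m\<close> m by presburger
    \<comment> \<open>Otherwise the rotated path starts outside \<open>A\<close> and its second
      vertex is in \<open>A\<close>; without its first vertex it is an odd path of order at least
      \<open>2 * k + 1\<close> with both ends in \<open>A\<close>.\<close>
    have flipA: "xs ! i \<in> A"
      if xs: "path_in xs" "length xs = ?m" "hd xs \<in> A" "last xs \<in> A" and i: "i \<in> links xs" for xs i
    proof (rule ccontr)
      assume "xs ! i \<notin> A"
      let ?q = "flip i xs"
      note q = flip[OF xs(1) i]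
      have "?q \<noteq> []" using q(1) by (simp add: path_in_def)
      then have "?q ! 0 \<notin> A"
        using q(2) \<open>xs ! i \<notin> A\<close> by (simp add: hd_conv_nth)
      then have "?q ! 1 \<in> A"
        using path_in_cover[OF q(1), of 0] xs(2) m k_pos by auto
      then have "hd (tl ?q) \<in> A" "last (tl ?q) = last ?q"
        using hd_tl_conv_nth[of ?q] last_tl_longer[of ?q] xs(2) m k_pos by auto
      moreover have "path_in (tl ?q)"
        using path_in_drop[OF q(1), of 1] xs(2) m k_pos by (simp add: drop_Suc)
      ultimately have "length (tl ?q) < 2 * k + 1"
        using odd_path_short[of "tl ?q"] q(3) xs(2,4) \<open>even ?m\<close> m ne by auto
      then show False using xs(2) mt m by simp
    qed
    have odd_notA: "xs ! (2 * s + 1) \<notin> A"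
      if "path_in xs" "length xs = ?m" "hd xs \<in> A" "s < t" for xs s
    proof -
      have "xs \<noteq> []" using that by (auto simp: path_in_def)
      then show ?thesis
        using path_prefix_alternates(2)[of xs s] that mt by (simp add: hd_conv_nth)
    qed
    have no_low: "2 * s + 1 \<notin> links xs"
      if "path_in xs" "length xs = ?m" "hd xs \<in> A" "last xs \<in> A" "s < t" for xs s
      using flipA[of xs "2 * s + 1"] odd_notA[of xs s] that by blast
    \<comment> \<open>If \<open>t\<close> were at least \<open>k\<close>, alternation would put
      position \<open>2 * k - 1\<close> outside \<open>A\<close>, and \<open>no_window\<close> does
      the same for \<open>2 * k\<close>, against \<open>path_in_cover\<close>. The bound keeps the
      two halves of \<open>Z\<close> below disjoint.\<close>
    have "t < k"
    proof (rule ccontr)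
      assume "\<not> t < k"
      then have "p ! (2 * (k - 1) + 1) \<notin> A"
        using odd_notA[OF p _ hdA, of "k - 1"] k_pos by simp
      moreover have "p ! (2 * k) \<notin> A"
        using no_window[OF p, of 0] hdA ne m by (simp add: hd_conv_nth)
      moreover have "2 * k = Suc (2 * (k - 1) + 1)" using k_pos by simp
      ultimately show False
        using path_in_cover[OF p, of "2 * (k - 1) + 1"] m by auto
    qed
    \<comment> \<open>Edge positions of the path that neither end can use: those leaving the vertices of \<open>B\<close>
      in the alternating initial segment, and their mirror images at the other end.\<close>
    define Z where "Z = (\<lambda>s. 2 * s + 1) ` {..<t} \<union> (\<lambda>s. 2 * s + 1) ` {k - 1..<k - 1 + t}"
    have cardZ: "card Z = 2 * t"
    proof -
      have "Z = (\<lambda>s. 2 * s + 1) ` ({..<t} \<union> {k - 1..<k - 1 + t})"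
        unfolding Z_def by (rule image_Un[symmetric])
      moreover have "card ({..<t} \<union> {k - 1..<k - 1 + t}) = 2 * t"
        using \<open>t < k\<close> by (subst card_Un_disjoint) auto
      ultimately show ?thesis
        by (simp add: card_image inj_on_def)
    qed
    have lastY: "?m - 2 - j \<in> links (rev p)" if j: "j \<in> Y" for j
    proof -
      obtain i where i: "i \<in> links (rev p)" "j = ?m - 2 - i"
        using j unfolding Y_def by blast
      then have "?m - 2 - j = i" by (auto simp: links_def)
      then show ?thesis using i(1) by simp
    qed
    \<comment> \<open>Positions in either half are barred to the nearer end by \<open>no_low\<close>
      and to the farther end by \<open>links_bound\<close>.\<close>
    have notZ: "z \<notin> X \<and> z \<notin> Y" if "z \<in> Z" for z
    proof -
      have revp: "path_in (rev p)" "length (rev p) = ?m" "hd (rev p) \<in> A" "last (rev p) \<in> A"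
        using p' hdA lastA ne by (auto simp: hd_rev last_rev)
      consider s where "s < t" "z = 2 * s + 1"
        | s where "k - 1 \<le> s" "s < k - 1 + t" "z = 2 * s + 1"
        using \<open>z \<in> Z\<close> by (auto simp: Z_def)
      then show ?thesis
      proof cases
        case 1
        have "z \<notin> Y"
        proof
          assume "z \<in> Y"
          from links_bound[OF p' lastY[OF this]] show False using 1 mt Y[OF \<open>z \<in> Y\<close>] by simp
        qed
        then show ?thesis
          using no_low[OF p _ hdA lastA, of s] 1 by (simp add: X_def)
      next
        case 2
        define s' where "s' = k + t - 2 - s"
        have "?m - 2 - z = 2 * s' + 1 \<and> s' < t"
          using 2 mt \<open>t < k\<close> by (auto simp: s'_def)
        then have "z \<notin> Y"
          using no_low[OF revp, of s'] lastY[of z] by auto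
        moreover have "z \<notin> X"
          using links_bound[OF p, of z] 2 by (auto simp: X_def)
        ultimately show ?thesis by blast
      qed
    qed
    have "finite Z" by (simp add: Z_def)
    have subZ: "X \<union> Y \<union> Z \<subseteq> {..<?m - 1}"
      using sub \<open>t < k\<close> mt by (auto simp: Z_def)
    have "card (X \<union> Y \<union> Z) = card X + card Y + card Z"
      using notZ True fin \<open>finite Z\<close> by (subst card_Un_disjoint, auto simp: card_Un_disjoint)
    then have "card X + card Y + 2 * t \<le> ?m - 1"
      using card_mono[OF _ subZ] cardZ by simp
    moreover have "card X \<ge> k" "card Y \<ge> k"
      using cardX cardY deg ends by auto
    ultimately show ?thesis using mt m by linarith
  qed
qed

end

section \<open>Vertex deletion and the degree sum bound\<close>

context graph_with_independent_part
begin

lemma subgraph: "graph_with_independent_part E (A - C) (B - C)"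
  using finite_A finite_B disjoint sym irrefl indep by unfold_locales auto

text \<open>The last two sums are what the deletion of \<open>C\<close> costs: degrees of deleted
  vertices, and edges from surviving vertices of \<open>A\<close> into \<open>C\<close>.\<close>

lemma degree_sum_delete:
  assumes "C \<subseteq> A \<union> B"
  shows "(\<Sum>a\<in>A. card (nbrs a)) =
    (\<Sum>a\<in>A - C. card {w \<in> (A - C) \<union> (B - C). E a w}) +
    (\<Sum>a\<in>A \<inter> C. card (nbrs a)) + (\<Sum>a\<in>A - C. card (nbrs a \<inter> C))"
proof -
  have "card (nbrs a) = card {w \<in> (A - C) \<union> (B - C). E a w} + card (nbrs a \<inter> C)" for a
  proof -
    have "nbrs a = {w \<in> (A - C) \<union> (B - C). E a w} \<union> (nbrs a \<inter> C)"
      using assms by (auto simp: nbrs_def)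
    moreover have "{w \<in> (A - C) \<union> (B - C). E a w} \<inter> (nbrs a \<inter> C) = {}"
      by auto
    ultimately show ?thesis
      by (metis (no_types, lifting) card_Un_disjoint finite_Un finite_nbrs)
  qed
  then have "(\<Sum>a\<in>A - C. card (nbrs a)) =
      (\<Sum>a\<in>A - C. card {w \<in> (A - C) \<union> (B - C). E a w}) + (\<Sum>a\<in>A - C. card (nbrs a \<inter> C))"
    by (simp add: sum.distrib)
  moreover have "(\<Sum>a\<in>A. card (nbrs a)) =
      (\<Sum>a\<in>A - C. card (nbrs a)) + (\<Sum>a\<in>A \<inter> C. card (nbrs a))"
    using finite_A sum.Int_Diff[of A "\<lambda>a. card (nbrs a)" C] by simp
  ultimately show ?thesis by simp
qed

lemma exists_longest_path:
  assumes "A \<union> B \<noteq> {}"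
  obtains p where "path_in p" "\<And>q. path_in q \<Longrightarrow> length q \<le> length p"
proof -
  obtain v where "v \<in> A \<union> B" using assms by blast
  then have "path_in [v]" by (auto simp: path_in_def)
  moreover have "length q \<le> card (A \<union> B)" if "path_in q" for q
    using that finite_A finite_B card_mono[of "A \<union> B" "set q"]
    by (auto simp: path_in_def distinct_card)
  ultimately obtain p where "path_in p" "\<forall>q. path_in q \<longrightarrow> length q \<le> length p"
    using ex_has_greatest_nat[of path_in "[v]" length "Suc (card (A \<union> B))"]
    by (auto simp: less_Suc_eq_le)
  then show thesis using that by blast
qed

end

context no_even_path
begin

lemma subgraph: "no_even_path E (A - C) (B - C) k"
proof -
  interpret sub: graph_with_independent_part E "A - C" "B - C"
    by (rule subgraph)
  have "path_in xs" if "sub.path_in xs" for xs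
    using that by (auto simp: path_in_def sub.path_in_def)
  then show ?thesis
    using k_pos no_path by unfold_locales blast+
qed

text \<open>A vertex of \<open>B\<close> of degree at most \<open>k\<close> costs at most
  \<open>k\<close>; a vertex of \<open>A\<close> of degree below \<open>k\<close> costs at most
  twice its degree. Failing both, a longest path closes to a cycle on at most \<open>2 * k\<close>
  vertices, which no edge leaves, so degrees there are at most \<open>2 * k - 1\<close>.\<close>

lemma exists_removable_part:
  assumes "A \<union> B \<noteq> {}"
  obtains C where "C \<subseteq> A \<union> B" "C \<noteq> {}"
    "(\<Sum>a\<in>A \<inter> C. card (nbrs a)) + (\<Sum>a\<in>A - C. card (nbrs a \<inter> C))
      \<le> (2 * k - 1) * card (A \<inter> C) + k * card (B \<inter> C)"
proof -
  have deg_to: "(\<Sum>a\<in>A - {v}. card (nbrs a \<inter> {v})) \<le> card (nbrs v)" if "v \<in> A \<union> B" for v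
  proof -
    have "(\<Sum>a\<in>A - {v}. card (nbrs a \<inter> {v})) = (\<Sum>a\<in>A - {v}. if E v a then 1 else 0)"
      using that sym by (intro sum.cong) (auto simp: nbrs_def Int_insert_right)
    also have "\<dots> = card {a \<in> A - {v}. E v a}"
      using finite_A by (simp add: sum.If_cases Int_def)
    also have "\<dots> \<le> card (nbrs v)"
      by (rule card_mono[OF finite_nbrs]) (auto simp: nbrs_def)
    finally show ?thesis .
  qed
  consider b where "b \<in> B" "card (nbrs b) \<le> k"
    | a where "a \<in> A" "card (nbrs a) < k"
    | "\<And>v. v \<in> A \<Longrightarrow> k \<le> card (nbrs v)" "\<And>v. v \<in> B \<Longrightarrow> k + 1 \<le> card (nbrs v)"
    by (metis Suc_eq_plus1 not_less not_less_eq_eq)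
  then show thesis
  proof cases
    case 1
    then have "A \<inter> {b} = {}" "B \<inter> {b} = {b}" using disjoint by auto
    then show thesis using that[of "{b}"] deg_to[of b] 1 by auto
  next
    case 2
    then have "A \<inter> {a} = {a}" "B \<inter> {a} = {}" using disjoint by auto
    then show thesis using that[of "{a}"] deg_to[of a] 2 by auto
  next
    case 3
    obtain p where p: "path_in p" "\<And>q. path_in q \<Longrightarrow> length q \<le> length p"
      using exists_longest_path[OF assms] by blast
    from longest_path_short[OF p 3] obtain q where
      q: "path_in q" "length q = length p" "length p \<le> 2 * k" "E (last q) (hd q)"
      by blast
    \<comment> \<open>Each vertex of the cycle starts some rotation of \<open>q\<close>, which is
      again a longest path.\<close>
    have closed: "nbrs v \<subseteq> set q" if "v \<in> set q" for v
    proof -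
      obtain i where i: "i < length q" "q ! i = v"
        using \<open>v \<in> set q\<close> by (auto simp: in_set_conv_nth)
      have "path_in (rotate i q)" using path_in_rotate q by blast
      then have "nbrs (hd (rotate i q)) \<subseteq> set (rotate i q)"
        using p(2) q(2) by (intro nbrs_hd_longest) auto
      moreover have "hd (rotate i q) = v"
        using i by (subst hd_rotate_conv_nth) auto
      ultimately show ?thesis by simp
    qed
    have len: "card (set q) = length q"
      using q by (simp add: path_in_def distinct_card)
    have "card (nbrs v) \<le> 2 * k - 1" if "v \<in> set q" for v
    proof -
      have "nbrs v \<subseteq> set q - {v}"
        using closed[OF that] irrefl by (auto simp: nbrs_def)
      then have "card (nbrs v) \<le> card (set q - {v})"
        by (intro card_mono) auto
      then show ?thesis using that len q by simp
    qed
    then have "(\<Sum>a\<in>A \<inter> set q. card (nbrs a)) \<le> (2 * k - 1) * card (A \<inter> set q)"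
      using sum_bounded_above[of "A \<inter> set q" "\<lambda>a. card (nbrs a)" "2 * k - 1"]
      by (simp add: mult.commute)
    moreover have "(\<Sum>a\<in>A - set q. card (nbrs a \<inter> set q)) = 0"
    proof -
      have "nbrs a \<inter> set q = {}" if "a \<in> A - set q" for a
      proof -
        have "a \<in> nbrs w" if "w \<in> nbrs a" for w
          using that \<open>a \<in> A - set q\<close> sym by (auto simp: nbrs_def)
        then show ?thesis using closed that by blast
      qed
      then show ?thesis by simp
    qed
    ultimately show thesis
      using q(1) by (intro that[of "set q"]) (auto simp: path_in_def)
  qed
qed

end

lemma (in no_even_path) degree_sum_le:
  "(\<Sum>a\<in>A. card (nbrs a)) \<le> (2 * k - 1) * card A + k * card B"
  \<comment> \<open>Passing the locale assumptions as a fact lets \<open>A\<close> and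
    \<open>B\<close> vary in the induction.\<close>
  using no_even_path_axioms
proof (induction "card (A \<union> B)" arbitrary: A B rule: less_induct)
  case less
  interpret g: no_even_path E A B k by (rule less.prems)
  show ?case
  proof (cases "A \<union> B = {}")
    case False
    then obtain C where C: "C \<subseteq> A \<union> B" "C \<noteq> {}"
      "(\<Sum>a\<in>A \<inter> C. card (g.nbrs a)) + (\<Sum>a\<in>A - C. card (g.nbrs a \<inter> C))
        \<le> (2 * k - 1) * card (A \<inter> C) + k * card (B \<inter> C)"
      using g.exists_removable_part by blast
    interpret sub: no_even_path E "A - C" "B - C" k by (rule g.subgraph)
    have "(A - C) \<union> (B - C) \<subset> A \<union> B" using C by blast
    then have "card ((A - C) \<union> (B - C)) < card (A \<union> B)"
      using g.finite_A g.finite_B by (intro psubset_card_mono) auto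
    from less.hyps[OF this sub.no_even_path_axioms]
    have "(\<Sum>a\<in>A - C. card (sub.nbrs a)) \<le> (2 * k - 1) * card (A - C) + k * card (B - C)" .
    moreover have "card A = card (A \<inter> C) + card (A - C)" "card B = card (B \<inter> C) + card (B - C)"
      using card_Int_Diff g.finite_A g.finite_B by auto
    ultimately show ?thesis
      using g.degree_sum_delete[OF C(1)] C(3)
      by (simp add: sub.nbrs_def distrib_left)
  qed simp
qed

section \<open>The largest eigenvalue of a nonnegative symmetric matrix\<close>

lemma inner_symmetric_matrix:
  fixes M :: "real^'n^'n"
  assumes "transpose M = M"
  shows "(M *v x) \<bullet> y = x \<bullet> (M *v y)"
proof -
  have "M *v x = x v* M"
    using transpose_matrix_vector[of M x] unfolding assms .
  then show ?thesis by (simp only: dot_lmul_matrix)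
qed

text \<open>Eigenvectors for distinct eigenvalues are orthogonal, hence independent. Finiteness is
  what gives \<open>Max\<close> in \<open>mu\<close> its meaning.\<close>

lemma finite_eigenvalues_symmetric:
  fixes M :: "real^'n^'n"
  assumes sym: "transpose M = M"
  shows "finite (eigenvalues M)"
proof -
  define v where "v c = (SOME x. x \<noteq> 0 \<and> M *v x = c *\<^sub>R x)" for c
  have v: "v c \<noteq> 0 \<and> M *v v c = c *\<^sub>R v c" if "c \<in> eigenvalues M" for c
    using someI_ex[of "\<lambda>x. x \<noteq> 0 \<and> M *v x = c *\<^sub>R x"] that
    by (simp add: v_def eigenvalues_def)
  have orth: "v c \<bullet> v d = 0" if "c \<in> eigenvalues M" "d \<in> eigenvalues M" "c \<noteq> d" for c d
  proof -
    have "c * (v c \<bullet> v d) = d * (v c \<bullet> v d)"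
      using inner_symmetric_matrix[OF sym, of "v c" "v d"] v[of c] v[of d] that by simp
    then show ?thesis using that by simp
  qed
  have "inj_on v (eigenvalues M)"
    using orth v by (metis inj_onI inner_eq_zero_iff)
  moreover have "independent (v ` eigenvalues M)"
    using orth v by (intro pairwise_orthogonal_independent) (auto simp: pairwise_def orthogonal_def)
  then have "finite (v ` eigenvalues M)"
    by (rule independent_imp_finite)
  ultimately show ?thesis
    by (simp add: finite_image_iff)
qed

text \<open>\<open>x\<close> minimizes the quadratic form, so its first variation in the direction
  \<open>M *v x\<close> vanishes.\<close>

lemma semidefinite_null_vector:
  fixes M :: "real^'n^'n"
  assumes sym: "transpose M = M" and psd: "\<And>y. y \<bullet> (M *v y) \<ge> 0" and null: "x \<bullet> (M *v x) = 0"
  shows "M *v x = 0"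
proof -
  define z where "z = M *v x"
  define q where "q = z \<bullet> (M *v z)"
  have expand: "2 * t * (z \<bullet> z) + t\<^sup>2 * q \<ge> 0" for t
  proof -
    have "(x + t *\<^sub>R z) \<bullet> (M *v (x + t *\<^sub>R z)) = 2 * t * (z \<bullet> z) + t\<^sup>2 * q"
      using null inner_symmetric_matrix[OF sym, of x z]
      by (simp add: matrix_vector_right_distrib matrix_vector_mult_scaleR inner_add
          q_def power2_eq_square inner_commute algebra_simps flip: z_def)
    then show ?thesis using psd by metis
  qed
  have "q \<ge> 0" using psd by (simp add: q_def)
  have "z \<bullet> z = 0"
  proof (rule ccontr)
    assume "z \<bullet> z \<noteq> 0"
    then have pos: "z \<bullet> z > 0" by simp
    \<comment> \<open>With this \<open>s\<close>, the form at \<open>t = - s\<close> equals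
      \<open>s\<close> times \<open>s * q - 2 * s * (q + 1)\<close>, which is negative.\<close>
    define s where "s = (z \<bullet> z) / (q + 1)"
    have "s > 0" "s * (q + 1) = z \<bullet> z"
      using pos \<open>q \<ge> 0\<close> by (auto simp: s_def)
    moreover have "s * (s * q - 2 * (z \<bullet> z)) \<ge> 0"
      using expand[of "- s"] by (simp add: power2_eq_square algebra_simps)
    ultimately have "s * q \<ge> 2 * (s * (q + 1))"
      by (simp add: zero_le_mult_iff)
    moreover have "s * q \<ge> 0"
      using \<open>s > 0\<close> \<open>q \<ge> 0\<close> by simp
    ultimately show False
      using \<open>s > 0\<close> unfolding distrib_left mult_1_right by linarith
  qed
  then show ?thesis by (simp add: z_def)
qed

lemma eigenvalue_le_rayleigh:
  fixes M :: "real^'n^'n"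
  assumes "\<And>y. y \<bullet> (M *v y) \<le> c * (y \<bullet> y)" and "d \<in> eigenvalues M"
  shows "d \<le> c"
proof -
  obtain x where x: "x \<noteq> 0" "M *v x = d *\<^sub>R x"
    using assms(2) by (auto simp: eigenvalues_def)
  have "d * (x \<bullet> x) \<le> c * (x \<bullet> x)"
    using assms(1)[of x] x by simp
  then show ?thesis using x by simp
qed

text \<open>The weak Perron-Frobenius theorem: for nonnegative entries, taking absolute values of a
  maximizer of the Rayleigh quotient does not lower the quotient. With \<open>c\<close> the maximum,
  \<open>c\<close> times the identity minus \<open>M\<close> is semidefinite, so the new maximizer
  is an eigenvector.\<close>

lemma max_eigenvalue_nonneg_vector:
  fixes M :: "real^'n^'n"
  assumes sym: "transpose M = M" and nonneg: "\<And>i j. M $ i $ j \<ge> 0"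
  obtains x where "x \<noteq> 0" "\<And>i. x $ i \<ge> 0" "M *v x = Max (eigenvalues M) *\<^sub>R x"
proof -
  let ?R = "\<lambda>x. x \<bullet> (M *v x)"
  have "continuous_on (sphere 0 1) ?R"
    by (intro continuous_intros linear_continuous_on matrix_vector_mul_bounded_linear)
  moreover have "compact (sphere (0::real^'n) 1)" "sphere (0::real^'n) 1 \<noteq> {}"
    by auto
  ultimately obtain x0 where x0: "norm x0 = 1" "\<And>y. norm y = 1 \<Longrightarrow> ?R y \<le> ?R x0"
    using continuous_attains_sup[of "sphere 0 1" ?R] by auto
  define c where "c = ?R x0"
  have bound: "?R y \<le> c * (y \<bullet> y)" for y
  proof (cases "y = 0")
    case False
    define u where "u = y /\<^sub>R norm y"
    have y: "y = norm y *\<^sub>R u" "norm u = 1"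
      using False by (auto simp: u_def)
    have "?R y = (norm y)\<^sup>2 * ?R u"
      by (subst y(1), subst (2) y(1)) (simp add: matrix_vector_mult_scaleR power2_eq_square)
    also have "\<dots> \<le> (norm y)\<^sup>2 * c"
      using x0(2)[OF y(2)] by (simp add: c_def mult_left_mono)
    finally show ?thesis by (simp add: power2_norm_eq_inner mult.commute)
  qed simp
  define x where "x = (\<chi> i. \<bar>x0 $ i\<bar>)"
  have xx: "x \<bullet> x = 1"
    using x0(1) by (simp add: x_def inner_vec_def norm_eq_1)
  have entry: "x0 $ i * (M $ i $ j * x0 $ j) \<le> \<bar>x0 $ i\<bar> * (M $ i $ j * \<bar>x0 $ j\<bar>)" for i j
    using abs_ge_self[of "x0 $ i * (M $ i $ j * x0 $ j)"] nonneg[of i j] by (simp add: abs_mult)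
  have "?R x0 \<le> ?R x"
    using entry unfolding inner_vec_def matrix_vector_mult_def x_def
    by (simp add: sum_distrib_left sum_mono)
  then have Rx: "?R x = c"
    using bound[of x] xx by (simp add: c_def)
  define N where "N = c *\<^sub>R mat 1 - M"
  have N: "N *v y = c *\<^sub>R y - M *v y" for y
    by (simp add: N_def matrix_vector_mult_diff_rdistrib scaleR_matrix_vector_assoc[symmetric])
  have "N *v x = 0"
  proof (rule semidefinite_null_vector)
    show "transpose N = N"
      using sym by (simp add: N_def transpose_def mat_def vec_eq_iff)
    show "y \<bullet> (N *v y) \<ge> 0" for y
      using bound[of y] by (simp add: N inner_diff_right)
    show "x \<bullet> (N *v x) = 0"
      using Rx xx by (simp add: N inner_diff_right)
  qed
  then have Mx: "M *v x = c *\<^sub>R x" by (simp add: N)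
  have "x \<noteq> 0" using xx by auto
  then have "c \<in> eigenvalues M"
    using Mx by (auto simp: eigenvalues_def)
  then have "Max (eigenvalues M) = c"
    using eigenvalue_le_rayleigh[OF bound] finite_eigenvalues_symmetric[OF sym]
    by (intro Max_eqI) auto
  then show thesis
    using that[of x] Mx \<open>x \<noteq> 0\<close> by (simp add: x_def)
qed

section \<open>Spectral radius and even cycles\<close>

text \<open>The left side is the row sum of the squared adjacency matrix at \<open>u\<close>. The
  degree sum bound applies to the graph without \<open>u\<close>, with \<open>A\<close> the
  neighbourhood of \<open>u\<close>.\<close>

lemma nbr_degree_sum_le:
  fixes E :: "'a::finite \<Rightarrow> 'a \<Rightarrow> bool"
  assumes "simple_graph E" and "k \<ge> 1" and no_cycle: "\<not> has_cycle E (2 * k + 2)"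
  shows "(\<Sum>v | E u v. card {w. E v w}) \<le> k * card {v. E u v} + k * (CARD('a) - 1)"
proof -
  have E_sym: "E v w \<Longrightarrow> E w v" and E_irrefl: "\<not> E v v" for v w
    using assms(1) by (auto simp: simple_graph_def)
  define A where "A = {v. E u v}"
  define B where "B = UNIV - A - {u}"
  \<comment> \<open>Dropping edges inside \<open>B\<close> makes \<open>B\<close> independent and
    leaves the degrees of vertices in \<open>A\<close> unchanged, except for the lost neighbour
    \<open>u\<close>.\<close>
  define F where "F v w \<longleftrightarrow> E v w \<and> v \<noteq> u \<and> w \<noteq> u \<and> (v \<in> A \<or> w \<in> A)" for v w
  interpret graph_with_independent_part F A B
    by unfold_locales (use E_sym E_irrefl in \<open>auto simp: F_def B_def\<close>)
  interpret no_even_path F A B k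
  proof
    fix xs assume xs: "path_in xs" "length xs = 2 * k + 1" "hd xs \<in> A"
    show "last xs \<notin> A"
    proof
      assume "last xs \<in> A"
      have ne: "xs \<noteq> []" using xs by auto
      have "u \<notin> set xs"
        using xs(1) E_irrefl unfolding path_in_def by (auto simp: A_def B_def)
      then have "distinct (u # xs)"
        using xs(1) by (simp add: path_in_def)
      moreover have "E ((u # xs) ! i) ((u # xs) ! ((i + 1) mod (2 * k + 2)))"
        if i: "i < 2 * k + 2" for i
      proof -
        consider "i = 0" | j where "i = Suc j" "Suc j < length xs" | "i = 2 * k + 1"
          using i xs(2) by (cases i) (auto simp: less_Suc_eq)
        then show ?thesis
        proof cases
          case 1
          then show ?thesis using xs(3) ne by (simp add: A_def hd_conv_nth)
        next
          case 2
          then have "F (xs ! j) (xs ! Suc j)"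
            using path_in_nth_edge[OF xs(1)] by simp
          then show ?thesis using 2 xs(2) by (simp add: F_def)
        next
          case 3
          then have "(u # xs) ! i = last xs"
            using xs(2) ne by (simp add: last_conv_nth)
          then show ?thesis
            using 3 \<open>last xs \<in> A\<close> E_sym by (simp add: A_def)
        qed
      qed
      ultimately have "has_cycle E (2 * k + 2)"
        unfolding has_cycle_def using xs(2) \<open>k \<ge> 1\<close> by (intro conjI exI[of _ "u # xs"]) auto
      then show False using no_cycle by blast
    qed
  qed (use \<open>k \<ge> 1\<close> in simp)
  have "card {w. E a w} = card (nbrs a) + 1" if "a \<in> A" for a
  proof -
    have "{w. E a w} = insert u (nbrs a)" "u \<notin> nbrs a"
      using that E_sym E_irrefl unfolding nbrs_def by (auto simp: F_def A_def B_def)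
    then show ?thesis by (simp add: finite_nbrs)
  qed
  then have "(\<Sum>a\<in>A. card {w. E a w}) = (\<Sum>a\<in>A. card (nbrs a)) + card A"
    by (simp add: sum_Suc)
  also have "\<dots> \<le> (2 * k - 1) * card A + k * card B + card A"
    using degree_sum_le by simp
  also have "\<dots> = 2 * k * card A + k * card B"
    using \<open>k \<ge> 1\<close> by (cases k) auto
  also have "card A + card B = CARD('a) - 1"
  proof -
    have "A \<union> B = UNIV - {u}"
      using E_irrefl by (auto simp: A_def B_def)
    then show ?thesis
      using card_Un_disjoint[OF finite_A finite_B disjoint] by simp
  qed
  then have "2 * k * card A + k * card B = k * card A + k * (CARD('a) - 1)"
    by (metis ab_semigroup_add_class.add_ac(1) add_mult_distrib2 mult_2 mult.assoc mult.left_commute)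
  finally show ?thesis by (simp add: A_def)
qed

text \<open>The hypothesis compares row sums of the squared matrix with those of the matrix.
  Weighting row \<open>i\<close> by the nonnegative entry \<open>x $ i\<close> turns them into
  powers of \<open>mu E\<close> times the sum \<open>s\<close> of the entries, and \<open>s\<close>
  is positive.\<close>

lemma mu_quadratic_bound:
  fixes E :: "'a::finite \<Rightarrow> 'a \<Rightarrow> bool"
  assumes "simple_graph E"
    and walks: "\<And>u. real (\<Sum>v | E u v. card {w. E v w}) \<le> p * real (card {v. E u v}) + q"
  shows "mu E ^ 2 \<le> p * mu E + q"
proof -
  have sym: "E v w \<longleftrightarrow> E w v" for v w
    using assms(1) by (auto simp: simple_graph_def)
  have "transpose (adj_matrix E) = adj_matrix E"
    using sym by (simp add: transpose_def adj_matrix_def vec_eq_iff)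
  moreover have "adj_matrix E $ i $ j \<ge> 0" for i j
    by (simp add: adj_matrix_def)
  ultimately obtain x where x: "x \<noteq> 0" "\<And>i. x $ i \<ge> 0"
    and eigen: "adj_matrix E *v x = mu E *\<^sub>R x"
    using max_eigenvalue_nonneg_vector[of "adj_matrix E"] unfolding mu_def by blast
  define d where "d v = real (card {w. E v w})" for v
  define s where "s = (\<Sum>i\<in>UNIV. x $ i)"
  have "s > 0"
  proof -
    obtain i where "x $ i \<noteq> 0" using x(1) by (auto simp: vec_eq_iff)
    then have "x $ i > 0" using x(2)[of i] by simp
    then show ?thesis
      unfolding s_def using x(2) by (intro sum_pos2[of UNIV i]) auto
  qed
  \<comment> \<open>\<open>x\<close> is also a left eigenvector, since the matrix is symmetric\<close>
  have transfer: "mu E * (\<Sum>i\<in>UNIV. g i * x $ i) = (\<Sum>i\<in>UNIV. (\<Sum>v | E i v. g v) * x $ i)"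
    for g :: "'a \<Rightarrow> real"
  proof -
    have "mu E * (\<Sum>i\<in>UNIV. g i * x $ i) = (\<Sum>i\<in>UNIV. g i * (adj_matrix E *v x) $ i)"
      by (simp add: eigen sum_distrib_left algebra_simps)
    also have "\<dots> = (\<Sum>i\<in>UNIV. \<Sum>j\<in>UNIV. if E i j then g i * x $ j else 0)"
      by (auto simp: matrix_vector_mult_def adj_matrix_def sum_distrib_left intro!: sum.cong)
    also have "\<dots> = (\<Sum>j\<in>UNIV. \<Sum>i\<in>UNIV. if E j i then g i * x $ j else 0)"
      by (subst sum.swap) (simp add: sym)
    also have "\<dots> = (\<Sum>j\<in>UNIV. (\<Sum>i | E j i. g i) * x $ j)"
      by (simp add: sum_distrib_right sum.If_cases)
    finally show ?thesis .
  qed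
  have degrees: "mu E * s = (\<Sum>i\<in>UNIV. d i * x $ i)"
    using transfer[of "\<lambda>_. 1"] by (simp add: s_def d_def)
  have "mu E ^ 2 * s = mu E * (\<Sum>i\<in>UNIV. d i * x $ i)"
    by (simp add: degrees[symmetric] power2_eq_square)
  also have "\<dots> = (\<Sum>i\<in>UNIV. (\<Sum>v | E i v. d v) * x $ i)"
    by (rule transfer)
  also have "\<dots> \<le> (\<Sum>i\<in>UNIV. (p * d i + q) * x $ i)"
    using walks x(2) by (intro sum_mono mult_right_mono) (auto simp: d_def)
  also have "\<dots> = p * (\<Sum>i\<in>UNIV. d i * x $ i) + q * s"
    by (simp add: s_def algebra_simps sum.distrib sum_distrib_left)
  also have "\<dots> = (p * mu E + q) * s"
    by (simp add: degrees[symmetric] algebra_simps)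
  finally show ?thesis
    using \<open>s > 0\<close> by simp
qed

theorem theorem2:
  fixes E :: "'a::finite \<Rightarrow> 'a \<Rightarrow> bool" and k :: nat
  assumes "simple_graph E"
    and "k \<ge> 1"
    and "mu E > real k / 2 + sqrt (real k * real CARD('a) + (real k ^ 2 - 4 * real k) / 4)"
  shows "\<forall>l\<in>{1..k}. has_cycle E (2 * l + 2)"
proof (rule ballI, rule ccontr)
  fix l assume l: "l \<in> {1..k}" and "\<not> has_cycle E (2 * l + 2)"
  define N where "N = real (CARD('a) - 1)"
  have N: "N \<ge> 0" "real CARD('a) = N + 1"
    by (simp_all add: N_def of_nat_diff Suc_leI)
  have "real (\<Sum>v | E u v. card {w. E v w}) \<le> real l * real (card {v. E u v}) + real l * N" for u
  proof -
    have "real (\<Sum>v | E u v. card {w. E v w})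
        \<le> real (l * card {v. E u v} + l * (CARD('a) - 1))"
      using nbr_degree_sum_le[OF assms(1) _ \<open>\<not> has_cycle E (2 * l + 2)\<close>, of u] l
      by (simp only: of_nat_le_iff atLeastAtMost_iff)
    then show ?thesis by (simp add: N_def)
  qed
  then have upper: "mu E ^ 2 \<le> real l * mu E + real l * N"
    by (rule mu_quadratic_bound[OF assms(1)])
  \<comment> \<open>This is the radicand of the hypothesis: substituting \<open>N + 1\<close> for
    the order cancels the term \<open>- 4 * real k / 4\<close>. Squaring then yields the opposite of
    \<open>upper\<close> with \<open>k\<close> in place of \<open>l\<close>.\<close>
  define r where "r = real k * N + (real k / 2)\<^sup>2"
  have "sqrt r < mu E - real k / 2"
    using assms(3) by (simp add: r_def N(2) power2_eq_square field_simps)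
  moreover have "r \<ge> 0" using N by (simp add: r_def)
  moreover from this have "sqrt r \<ge> 0" by simp
  ultimately have "r < (mu E - real k / 2)\<^sup>2" "mu E \<ge> real k / 2"
    using power_strict_mono[of "sqrt r" "mu E - real k / 2" 2] by (simp, linarith)
  then have "real k * mu E + real k * N < mu E ^ 2" "mu E \<ge> 0"
    by (simp_all add: r_def power2_eq_square algebra_simps)
  moreover have "real l * mu E + real l * N \<le> real k * mu E + real k * N"
    using l N \<open>mu E \<ge> 0\<close> by (intro add_mono mult_right_mono) auto
  ultimately show False using upper by linarith
qed

end
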